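(* The class of transitive Kripke frames in which the rule $(\Diamond^{*})$ is weakly valid is a proper subclass of the class of transitive and conversely well-founded Kripke frames.
   Context: Modal formulas are built from a countably infinite set $\mathsf{Prop}$ of propositional variables and $\top,\bot$ using $\land$, $\neg$ and $\Box$; $\lor$ and $\supset$ are defined in the usual way, $\Diamond\phi$ abbreviates $\neg\Box\neg\phi$, and $\Diamond^{n}$ is the $n$-fold application of $\Diamond$. A Kripke frame is a pair $F=\langle W,R\rangle$ with $W$ a non-empty set and $R$ a binary relation on $W$; it is transitive if $R$ is transitive, and conversely well-founded if there is no infinite sequence $(w_i)_{i\in\omega}$ of elements of $W$ with $(w_i,w_{i+1})\in R$ for every $i\in\omega$. A valuation on $F$ is a map $v:\mathsf{Prop}\to\mathcal{P}(W)$, extended to all formulas by $v(\top)=W$, $v(\bot)=\emptyset$, $v(\phi\land\psi)=v(\phi)\cap v(\psi)$, $v(\neg\phi)=W\setminus v(\phi)$, $v(\Box\phi)=\{w\in W\mid \forall w'\in W\,((w,w')\in R\Rightarrow w'\in v(\phi))\}$. A formula $\phi$ is valid in $F$ ($F\models\phi$) if $v(\phi)=W$ for every valuation $v$ on $F$; a set $\Gamma$ of formulas is valid in $F$ ($F\models\Gamma$) if every $\gamma\in\Gamma$ is valid in $F$. An inference rule is a pair $(\Gamma,\phi)$ of a (possibly infinite) set $\Gamma$ of formulas and a formula $\phi$. It is weakly valid in $F$ if $F\models\Gamma$ implies $F\models\phi$. The rule $(\Diamond^{*})$ is the scheme consisting of all pairs $(\{\phi\supset\Diamond^{n}\top\mid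 n\in\omega\},\ \phi\supset\bot)$, where $\phi$ ranges over all formulas; it is weakly valid in $F$ if all these pairs are weakly valid in $F$. *)

theory Defs
  imports Main
begin

(* Propositional variables are indexed by nat. *)
datatype fm =
    Var nat
  | Top
  | Bot
  | Conj fm fm
  | Neg fm
  | Box fm

definition Disj :: "fm \<Rightarrow> fm \<Rightarrow> fm" where
  "Disj \<phi> \<psi> = Neg (Conj (Neg \<phi>) (Neg \<psi>))"

definition Imp :: "fm \<Rightarrow> fm \<Rightarrow> fm" where
  "Imp \<phi> \<psi> = Disj (Neg \<phi>) \<psi>"

definition Dia :: "fm \<Rightarrow> fm" where
  "Dia \<phi> = Neg (Box (Neg \<phi>))"

record 'w kframe =
  worlds :: "'w set"
  acc :: "('w \<times> 'w) set"

definition kripke_frame :: "'w kframe \<Rightarrow> bool" where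
  "kripke_frame F \<longleftrightarrow> worlds F \<noteq> {} \<and> acc F \<subseteq> worlds F \<times> worlds F"

definition conversely_well_founded :: "'w kframe \<Rightarrow> bool" where
  "conversely_well_founded F \<longleftrightarrow>
     \<not> (\<exists>w :: nat \<Rightarrow> 'w. (\<forall>i. w i \<in> worlds F) \<and> (\<forall>i. (w i, w (Suc i)) \<in> acc F))"

definition valuation :: "'w kframe \<Rightarrow> (nat \<Rightarrow> 'w set) \<Rightarrow> bool" where
  "valuation F v \<longleftrightarrow> (\<forall>p. v p \<subseteq> worlds F)"

primrec ext :: "'w kframe \<Rightarrow> (nat \<Rightarrow> 'w set) \<Rightarrow> fm \<Rightarrow> 'w set" where
  "ext F v (Var p) = v p"
| "ext F v Top = worlds F"
| "ext F v Bot = {}"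
| "ext F v (Conj \<phi> \<psi>) = ext F v \<phi> \<inter> ext F v \<psi>"
| "ext F v (Neg \<phi>) = worlds F - ext F v \<phi>"
| "ext F v (Box \<phi>) =
     {w \<in> worlds F. \<forall>w' \<in> worlds F. (w, w') \<in> acc F \<longrightarrow> w' \<in> ext F v \<phi>}"

definition valid :: "'w kframe \<Rightarrow> fm \<Rightarrow> bool" where
  "valid F \<phi> \<longleftrightarrow> (\<forall>v. valuation F v \<longrightarrow> ext F v \<phi> = worlds F)"

definition valid_set :: "'w kframe \<Rightarrow> fm set \<Rightarrow> bool" where
  "valid_set F \<Gamma> \<longleftrightarrow> (\<forall>\<gamma> \<in> \<Gamma>. valid F \<gamma>)"

type_synonym inference_rule = "fm set \<times> fm"

definition weakly_valid :: "'w kframe \<Rightarrow> inference_rule \<Rightarrow> bool" where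
  "weakly_valid F r \<longleftrightarrow> (valid_set F (fst r) \<longrightarrow> valid F (snd r))"

definition weakly_valid_scheme :: "'w kframe \<Rightarrow> inference_rule set \<Rightarrow> bool" where
  "weakly_valid_scheme F S \<longleftrightarrow> (\<forall>r \<in> S. weakly_valid F r)"

definition dia_star :: "inference_rule set" where
  "dia_star = {({Imp \<phi> ((Dia ^^ n) Top) | n. True}, Imp \<phi> Bot) | \<phi>. True}"

(* HOL cannot collect frames over all types into one class; these are the
   frames whose worlds are drawn from the universe 'w. *)
definition dia_star_frames :: "'w kframe set" where
  "dia_star_frames =
     {F. kripke_frame F \<and> trans (acc F) \<and> weakly_valid_scheme F dia_star}"

definition transitive_cwf_frames :: "'w kframe set" where
  "transitive_cwf_frames =
     {F. kripke_frame F \<and> trans (acc F) \<and> conversely_well_founded F}"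

end

theory Submission
  imports Defs
begin

text \<open>
  In a frame, weak validity of the rule says: a formula all of whose satisfying worlds, under
  all valuations, start paths of every finite length is not satisfiable at all
  (\<open>dia_star_iff\<close>). Both halves of the theorem exhibit a suitable formula.

  Inclusion: on transitive frames the formula \<open>\<Diamond>p \<and> \<box>(p \<supset> \<Diamond>p)\<close> is true at
  a world for some valuation exactly when an infinite path starts there: the truth set of \<open>p\<close>
  then has no last element above the world, and conversely \<open>p\<close> can be read as ``lies on the path''.
  Such a world satisfies every \<open>\<Diamond>\<^sup>n\<top>\<close>, so the rule forces the formula to be
  unsatisfiable and hence excludes infinite paths (\<open>ascent_imp_Dia_pow_Top\<close>,
  \<open>chain_start_satisfies_ascent\<close>).

  Properness: a conversely well-founded frame violates the rule if some formula can be true only at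
  worlds of infinite rank. A reversed copy of \<open>\<omega>\<close> with a root below it does not suffice,
  since a formula satisfiable at the root of a linear order of this kind is already satisfiable in
  a finite final segment. The remedy is to let the root see one more dead end. The root is then the only
  world seeing two different dead ends, and this is expressed by the satisfiability of
  \<open>\<Diamond>(p \<and> \<box>\<bottom>) \<and> \<Diamond>(\<not>p \<and> \<box>\<bottom>)\<close>.
  Being below chains of every finite length, the root satisfies every \<open>\<Diamond>\<^sup>n\<top>\<close>.
\<close>

section \<open>Semantics of the derived connectives and of the rule\<close>

lemma ext_subset_worlds: "valuation F v \<Longrightarrow> ext F v \<phi> \<subseteq> worlds F"
  by (induction \<phi>) (auto simp: valuation_def)

lemma ext_Dia:
  "ext F v (Dia \<phi>) = {w \<in> worlds F. \<exists>w' \<in> worlds F. (w, w') \<in> acc F \<and> w' \<in> ext F v \<phi>}"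
  by (auto simp: Dia_def)

lemma ext_Imp:
  "valuation F v \<Longrightarrow> ext F v (Imp \<phi> \<psi>) = (worlds F - ext F v \<phi>) \<union> ext F v \<psi>"
  using ext_subset_worlds[of F v \<phi>] ext_subset_worlds[of F v \<psi>]
  by (auto simp: Imp_def Disj_def)

lemma valid_Imp_iff:
  "valid F (Imp \<phi> \<psi>) \<longleftrightarrow> (\<forall>v. valuation F v \<longrightarrow> ext F v \<phi> \<subseteq> ext F v \<psi>)"
proof -
  have "ext F v (Imp \<phi> \<psi>) = worlds F \<longleftrightarrow> ext F v \<phi> \<subseteq> ext F v \<psi>"
    if "valuation F v" for v
    using ext_subset_worlds[OF that, of \<phi>] ext_subset_worlds[OF that, of \<psi>]
    by (auto simp: ext_Imp[OF that])
  then show ?thesis by (auto simp: valid_def)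
qed

lemma dia_star_iff:
  "weakly_valid_scheme F dia_star \<longleftrightarrow>
     (\<forall>\<phi>. (\<forall>n v. valuation F v \<longrightarrow> ext F v \<phi> \<subseteq> ext F v ((Dia ^^ n) Top))
        \<longrightarrow> (\<forall>v. valuation F v \<longrightarrow> ext F v \<phi> = {}))"
proof -
  have "valid_set F {Imp \<phi> ((Dia ^^ n) Top) | n. True} \<longleftrightarrow>
      (\<forall>n. valid F (Imp \<phi> ((Dia ^^ n) Top)))" for \<phi>
    unfolding valid_set_def by blast
  moreover have "weakly_valid_scheme F dia_star \<longleftrightarrow>
      (\<forall>\<phi>. weakly_valid F ({Imp \<phi> ((Dia ^^ n) Top) | n. True}, Imp \<phi> Bot))"
    unfolding weakly_valid_scheme_def dia_star_def by blast
  ultimately have "weakly_valid_scheme F dia_star \<longleftrightarrow>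
      (\<forall>\<phi>. (\<forall>n. valid F (Imp \<phi> ((Dia ^^ n) Top))) \<longrightarrow> valid F (Imp \<phi> Bot))"
    by (simp only: weakly_valid_def fst_conv snd_conv)
  then show ?thesis by (simp add: valid_Imp_iff)
qed

text \<open>
  A path can be prolonged forever inside a set of worlds each of which has a successor in the set.
  This replaces the explicit construction of infinite paths.
\<close>

lemma serial_subset_Dia_pow_Top:
  assumes "S \<subseteq> worlds F" and "\<And>x. x \<in> S \<Longrightarrow> \<exists>y \<in> S. (x, y) \<in> acc F"
  shows "S \<subseteq> ext F v ((Dia ^^ n) Top)"
proof (induction n)
  case 0
  show ?case using assms(1) by simp
next
  case (Suc n)
  show ?case
  proof
    fix x assume "x \<in> S"
    with assms(2) obtain y where "y \<in> S" "(x, y) \<in> acc F" by blast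
    then show "x \<in> ext F v ((Dia ^^ Suc n) Top)"
      using Suc.IH assms(1) \<open>x \<in> S\<close> by (auto simp: ext_Dia)
  qed
qed

section \<open>The rule excludes infinite paths\<close>

text \<open>A modal description of starting an infinite path, via a set \<open>p\<close> without last element.\<close>

definition ascent :: fm where
  "ascent = Conj (Dia (Var 0)) (Box (Imp (Var 0) (Dia (Var 0))))"

lemma ext_ascent:
  assumes "valuation F v"
  shows "w \<in> ext F v ascent \<longleftrightarrow>
    w \<in> worlds F \<and> (\<exists>y \<in> worlds F. (w, y) \<in> acc F \<and> y \<in> v 0) \<and>
    (\<forall>x \<in> worlds F. (w, x) \<in> acc F \<longrightarrow> x \<in> v 0 \<longrightarrow>
       (\<exists>y \<in> worlds F. (x, y) \<in> acc F \<and> y \<in> v 0))"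
  by (auto simp: ascent_def ext_Dia ext_Imp[OF assms])

lemma ascent_imp_Dia_pow_Top:
  assumes "trans (acc F)" and "valuation F v"
  shows "ext F v ascent \<subseteq> ext F v ((Dia ^^ n) Top)"
proof
  fix w assume w: "w \<in> ext F v ascent"
  let ?S = "insert w {x \<in> worlds F. (w, x) \<in> acc F \<and> x \<in> v 0}"
  \<comment> \<open>By transitivity the successors in \<open>v 0\<close> provided by the box are again successors of \<open>w\<close>.\<close>
  have "\<exists>y \<in> ?S. (x, y) \<in> acc F" if "x \<in> ?S" for x
    using that w transD[OF assms(1)] unfolding ext_ascent[OF assms(2)] by blast
  moreover have "?S \<subseteq> worlds F"
    using w by (auto simp: ext_ascent[OF assms(2)])
  ultimately have "?S \<subseteq> ext F v ((Dia ^^ n) Top)"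
    by (intro serial_subset_Dia_pow_Top)
  then show "w \<in> ext F v ((Dia ^^ n) Top)" by simp
qed

lemma chain_start_satisfies_ascent:
  assumes "\<forall>i. c i \<in> worlds F" and "\<forall>i. (c i, c (Suc i)) \<in> acc F"
  shows "valuation F (\<lambda>_. range c)" and "c 0 \<in> ext F (\<lambda>_. range c) ascent"
proof -
  show val: "valuation F (\<lambda>_. range c)" using assms(1) by (auto simp: valuation_def)
  show "c 0 \<in> ext F (\<lambda>_. range c) ascent"
    unfolding ext_ascent[OF val] using assms by blast
qed

lemma dia_star_imp_conversely_well_founded:
  assumes "trans (acc F)" and "weakly_valid_scheme F dia_star"
  shows "conversely_well_founded F"
proof (rule ccontr)
  assume "\<not> conversely_well_founded F"
  then obtain c where c: "\<forall>i. c i \<in> worlds F" "\<forall>i. (c i, c (Suc i)) \<in> acc F"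
    by (auto simp: conversely_well_founded_def)
  have "\<forall>n v. valuation F v \<longrightarrow> ext F v ascent \<subseteq> ext F v ((Dia ^^ n) Top)"
    using ascent_imp_Dia_pow_Top[OF assms(1)] by blast
  with assms(2) have "ext F (\<lambda>_. range c) ascent = {}"
    using chain_start_satisfies_ascent(1)[OF c] unfolding dia_star_iff by blast
  with chain_start_satisfies_ascent(2)[OF c] show False by simp
qed

section \<open>A conversely well-founded frame violating the rule\<close>

text \<open>
  The root is \<open>0\<close>, which sees all other numbers; \<open>1\<close> is the additional dead end; the numbers from
  \<open>2\<close> on form the reversed copy of \<open>\<omega>\<close>, with the dead end \<open>2\<close>.
\<close>

definition spine :: "nat \<Rightarrow> nat \<Rightarrow> bool" where
  "spine m n \<longleftrightarrow> (m = 0 \<and> 0 < n) \<or> (2 \<le> n \<and> n < m)"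

text \<open>The relation is copied along \<open>f\<close> so that it can live in any infinite universe.\<close>

definition spine_frame :: "(nat \<Rightarrow> 'w) \<Rightarrow> 'w kframe" where
  "spine_frame f = \<lparr>worlds = range f, acc = {(f m, f n) | m n. spine m n}\<rparr>"

definition two_dead_ends :: fm where
  "two_dead_ends =
     Conj (Dia (Conj (Var 0) (Box Bot))) (Dia (Conj (Neg (Var 0)) (Box Bot)))"

lemma worlds_spine_frame [simp]: "worlds (spine_frame f) = range f"
  by (simp add: spine_frame_def)

lemma acc_spine_frame [simp]:
  "inj f \<Longrightarrow> (f m, f n) \<in> acc (spine_frame f) \<longleftrightarrow> spine m n"
  by (auto simp: spine_frame_def dest: injD)

lemma kripke_frame_spine_frame: "kripke_frame (spine_frame f)"
  by (auto simp: kripke_frame_def spine_frame_def)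

lemma trans_spine_frame:
  assumes "inj f"
  shows "trans (acc (spine_frame f))"
proof (rule transI)
  fix x y z assume xyz: "(x, y) \<in> acc (spine_frame f)" "(y, z) \<in> acc (spine_frame f)"
  then obtain k m n where eqs: "x = f k" "y = f m" "z = f n"
    by (auto simp: spine_frame_def)
  with xyz assms have "spine k m" "spine m n" by simp_all
  then have "spine k n" by (auto simp: spine_def)
  then show "(x, z) \<in> acc (spine_frame f)"
    using eqs assms by simp
qed

lemma conversely_well_founded_spine_frame:
  assumes "inj f"
  shows "conversely_well_founded (spine_frame f)"
  unfolding conversely_well_founded_def
proof
  assume "\<exists>w. (\<forall>i. w i \<in> worlds (spine_frame f)) \<and>
    (\<forall>i. (w i, w (Suc i)) \<in> acc (spine_frame f))"
  then obtain w where w: "\<forall>i. w i \<in> range f" "\<forall>i. (w i, w (Suc i)) \<in> acc (spine_frame f)"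
    unfolding worlds_spine_frame by blast
  define c where "c i = inv f (w i)" for i
  have "\<forall>i. w i = f (c i)" using w(1) by (simp add: c_def f_inv_into_f)
  with w(2) assms have c: "spine (c i) (c (Suc i))" for i by simp
  \<comment> \<open>Only the first step can leave the root; every later one goes down in the natural numbers.\<close>
  have "c (Suc (Suc i)) < c (Suc i)" for i
    using c[of i] c[of "Suc i"] by (auto simp: spine_def)
  then show False
    using wf_no_infinite_down_chainE[OF wf_less, of "\<lambda>i. c (Suc i)"] by auto
qed

lemma ext_two_dead_ends:
  assumes "inj f"
  shows "f k \<in> ext (spine_frame f) v two_dead_ends \<longleftrightarrow>
    (\<exists>m. spine k m \<and> f m \<in> v 0 \<and> (\<forall>j. \<not> spine m j)) \<and>
    (\<exists>n. spine k n \<and> f n \<notin> v 0 \<and> (\<forall>j. \<not> spine n j))"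
  using assms by (auto simp: two_dead_ends_def ext_Dia)

lemma spine_dead_end_iff: "(\<forall>j. \<not> spine m j) \<longleftrightarrow> m = 1 \<or> m = 2"
proof
  assume "\<forall>j. \<not> spine m j"
  then have "\<not> spine m 1" "\<not> spine m 2" by auto
  then show "m = 1 \<or> m = 2" by (auto simp: spine_def)
qed (auto simp: spine_def)

text \<open>
  The two dead ends named by the formula differ because the variable separates them, so one of them
  is \<open>1\<close>, which is visible from the root only.
\<close>

lemma two_dead_ends_only_at_root:
  assumes "inj f" and "f k \<in> ext (spine_frame f) v two_dead_ends"
  shows "k = 0"
proof -
  from assms(2) obtain m n where mn: "spine k m" "f m \<in> v 0" "spine k n" "f n \<notin> v 0"
    and "m \<in> {1, 2}" "n \<in> {1, 2}"
    unfolding ext_two_dead_ends[OF assms(1)] spine_dead_end_iff by blast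
  with mn have "m = 1 \<or> n = 1" by auto
  with mn show "k = 0" by (auto simp: spine_def)
qed

lemma root_satisfies_two_dead_ends:
  assumes "inj f"
  shows "f 0 \<in> ext (spine_frame f) (\<lambda>_. {f 1}) two_dead_ends"
proof -
  have "spine 0 1" "spine 0 2" by (auto simp: spine_def)
  moreover have "f 2 \<noteq> f 1" using assms by (auto dest: injD)
  ultimately show ?thesis
    unfolding ext_two_dead_ends[OF assms] spine_dead_end_iff by auto
qed

lemma spine_frame_Dia_pow_Top:
  assumes "inj f"
  shows "f (n + 2) \<in> ext (spine_frame f) v ((Dia ^^ n) Top)"
proof (induction n)
  case (Suc n)
  moreover have "spine (Suc n + 2) (n + 2)" by (simp add: spine_def)
  ultimately show ?case using assms by (auto simp: ext_Dia)
qed simp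

lemma root_satisfies_Dia_pow_Top:
  assumes "inj f"
  shows "f 0 \<in> ext (spine_frame f) v ((Dia ^^ n) Top)"
proof (cases n)
  case (Suc k)
  moreover have "spine 0 (k + 2)" by (simp add: spine_def)
  ultimately show ?thesis
    using assms spine_frame_Dia_pow_Top[OF assms, of k v] by (auto simp: ext_Dia)
qed simp

lemma spine_frame_violates_dia_star:
  assumes "inj f"
  shows "\<not> weakly_valid_scheme (spine_frame f) dia_star"
proof
  assume rule: "weakly_valid_scheme (spine_frame f) dia_star"
  have "ext (spine_frame f) v two_dead_ends \<subseteq> ext (spine_frame f) v ((Dia ^^ n) Top)"
    if "valuation (spine_frame f) v" for n v
  proof
    fix x assume x: "x \<in> ext (spine_frame f) v two_dead_ends"
    then have "x \<in> range f" using ext_subset_worlds[OF that] by auto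
    then obtain k where "x = f k" by blast
    with x two_dead_ends_only_at_root[OF assms] have "x = f 0" by blast
    then show "x \<in> ext (spine_frame f) v ((Dia ^^ n) Top)"
      using root_satisfies_Dia_pow_Top[OF assms] by simp
  qed
  moreover have "valuation (spine_frame f) (\<lambda>_. {f 1})" by (simp add: valuation_def)
  ultimately have "ext (spine_frame f) (\<lambda>_. {f 1}) two_dead_ends = {}"
    using rule unfolding dia_star_iff by blast
  then show False using root_satisfies_two_dead_ends[OF assms] by simp
qed

section \<open>The proper inclusion\<close>

theorem theorem5p4:
  "(dia_star_frames :: 'w kframe set) \<subseteq> transitive_cwf_frames \<and>
   (infinite (UNIV :: 'w set) \<longrightarrow>
      (dia_star_frames :: 'w kframe set) \<subset> transitive_cwf_frames)"
proof (intro conjI impI)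
  show incl: "(dia_star_frames :: 'w kframe set) \<subseteq> transitive_cwf_frames"
    using dia_star_imp_conversely_well_founded
    by (auto simp: dia_star_frames_def transitive_cwf_frames_def)
  assume "infinite (UNIV :: 'w set)"
  then obtain f :: "nat \<Rightarrow> 'w" where f: "inj f"
    using infinite_countable_subset by blast
  have "spine_frame f \<in> transitive_cwf_frames"
    using kripke_frame_spine_frame trans_spine_frame[OF f] conversely_well_founded_spine_frame[OF f]
    by (simp add: transitive_cwf_frames_def)
  moreover have "spine_frame f \<notin> dia_star_frames"
    using spine_frame_violates_dia_star[OF f] by (simp add: dia_star_frames_def)
  ultimately show "(dia_star_frames :: 'w kframe set) \<subset> transitive_cwf_frames"
    using incl by blast
qed

end
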